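(* Let $\mathcal G$ be a uniformly computably enumerable family. Then either $\mathcal G$ is TxtBC-learnable, or for each computable learning machine $M$ there is a $\Delta^0_2$ enumeration $f$ of a set in $\mathcal G$ such that $M$ fails to TxtBC-identify $f$.
   Context: Fix a computable pairing function $\langle\cdot,\cdot\rangle:\mathbb N^2\to\mathbb N$ and a standard numbering $W_0,W_1,\dots$ of the computably enumerable (c.e.) sets. A family $\mathcal G=\{G_0,G_1,\dots\}$ is uniformly computably enumerable (u.c.e.) if there is a c.e. set $A$ with $G_i=\{x:\langle i,x\rangle\in A\}$ for all $i$. An enumeration is a function $f:\mathbb N\to\mathbb N$; it is a $\Delta^0_2$ enumeration if $f$ is a $\Delta^0_2$ function (equivalently, a pointwise limit $f(n)=\lim_s f_s(n)$ of a uniformly computable sequence of functions $f_s$). $\mathrm{content}(f)=\{x:(\exists n)\,f(n)=x\}$; $f$ is an enumeration of (for) a set $A$ if $\mathrm{content}(f)=A$. $f\upharpoonright i$ is the initial segment of $f$ of length $i$, a finite string of natural numbers. A computable learning machine (computable learner) is a (possibly partial) computable function $M$ from finite strings of natural numbers to $\mathbb N$; a statement about a value of $M$ includes that this value is defined. $M$ TxtBC-identifies an enumeration $f$ if there is $n$ such that $W_{M(f\upharpoonright i)}=\mathrm{content}(f)$ for all $i>n$. $M$ TxtBC-learns a c.e. set $A$ if it TxtBC-identifies every (arbitrary, not necessarily computable) enumeration of $A$. $M$ TxtBC-learns a family of c.e. sets if it TxtBC-learns every member of the family. A family is TxtBC-learnable if some computable learning machine TxtBC-learns it. *)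

theory Defs
  imports "HOL-Library.Nat_Bijection"
begin

section \<open>Partial computable functions\<close>

text \<open>
  Kleene's partial recursive functions, presented as unary functions: several arguments are
  passed through the Cantor pairing function \<^const>\<open>prod_encode\<close>, whose inverse projections
  are among the initial functions.
\<close>

datatype prog =
    Zero | Succ | Fst | Snd
  | Tuple prog prog
  | Comp prog prog
  | Prec prog prog
  | Mu prog

text \<open>
  \<open>None\<close> means divergence.  \<open>Prec f g\<close> maps \<open>(a, n)\<close> to \<open>h n\<close>, where \<open>h 0 = f a\<close> and
  \<open>h (k + 1) = g (a, (k, h k))\<close>.  \<open>Mu f\<close> maps \<open>a\<close> to the least \<open>n\<close> with \<open>f (a, n) = 0\<close> and
  diverges unless \<open>f (a, m)\<close> converges for all \<open>m \<le> n\<close>.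
\<close>

primrec eval :: "prog \<Rightarrow> nat \<Rightarrow> nat option" where
  "eval Zero = (\<lambda>x. Some 0)"
| "eval Succ = (\<lambda>x. Some (Suc x))"
| "eval Fst = (\<lambda>x. Some (fst (prod_decode x)))"
| "eval Snd = (\<lambda>x. Some (snd (prod_decode x)))"
| "eval (Tuple f g) =
     (\<lambda>x. Option.bind (eval f x) (\<lambda>a. Option.bind (eval g x) (\<lambda>b. Some (prod_encode (a, b)))))"
| "eval (Comp f g) = (\<lambda>x. Option.bind (eval g x) (eval f))"
| "eval (Prec f g) =
     (\<lambda>x. case prod_decode x of (a, n) \<Rightarrow>
        rec_nat (eval f a)
          (\<lambda>k r. Option.bind r (\<lambda>v. eval g (prod_encode (a, prod_encode (k, v))))) n)"
| "eval (Mu f) =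
     (\<lambda>a. if \<exists>n. eval f (prod_encode (a, n)) = Some 0
                 \<and> (\<forall>m<n. eval f (prod_encode (a, m)) \<noteq> None)
           then Some (LEAST n. eval f (prod_encode (a, n)) = Some 0)
           else None)"

definition partial_computable :: "(nat \<Rightarrow> nat option) \<Rightarrow> bool" where
  "partial_computable \<phi> \<longleftrightarrow> (\<exists>p. \<phi> = eval p)"

definition decidable :: "nat set \<Rightarrow> bool" where
  "decidable A \<longleftrightarrow> partial_computable (\<lambda>x. Some (if x \<in> A then 1 else 0))"

definition ce :: "nat set \<Rightarrow> bool" where
  "ce A \<longleftrightarrow> (\<exists>\<phi>. partial_computable \<phi> \<and> A = dom \<phi>)"


section \<open>The standard numbering of the c.e.\ sets\<close>

lemma prod_decode_le: "fst (prod_decode m) \<le> m" "snd (prod_decode m) \<le> m"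
  using le_prod_encode_1[of "fst (prod_decode m)" "snd (prod_decode m)"]
    le_prod_encode_2[of "snd (prod_decode m)" "fst (prod_decode m)"]
  by simp_all

function decode_prog :: "nat \<Rightarrow> prog" where
  "decode_prog 0 = Zero"
| "decode_prog (Suc 0) = Succ"
| "decode_prog (Suc (Suc 0)) = Fst"
| "decode_prog (Suc (Suc (Suc 0))) = Snd"
| "decode_prog (Suc (Suc (Suc (Suc n)))) =
     (let m = n div 4; r = n mod 4; a = fst (prod_decode m); b = snd (prod_decode m) in
      if r = 0 then Tuple (decode_prog a) (decode_prog b)
      else if r = 1 then Comp (decode_prog a) (decode_prog b)
      else if r = 2 then Prec (decode_prog a) (decode_prog b)
      else Mu (decode_prog m))"
  by pat_completeness auto

termination decode_prog
proof (relation "measure id")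
  have *: "k div 4 < Suc (Suc (Suc (Suc k)))" for k :: nat
    using div_le_dividend[of k 4] by linarith
  have "fst (prod_decode (k div 4)) < Suc (Suc (Suc (Suc k)))"
    "snd (prod_decode (k div 4)) < Suc (Suc (Suc (Suc k)))" for k :: nat
    using * prod_decode_le le_less_trans by blast+
  with * show
    "\<And>n x xa xb xc. x = n div 4 \<Longrightarrow> xa = n mod 4 \<Longrightarrow> xb = fst (prod_decode x) \<Longrightarrow>
       xc = snd (prod_decode x) \<Longrightarrow> xa \<noteq> 0 \<Longrightarrow> xa \<noteq> 1 \<Longrightarrow> xa \<noteq> 2 \<Longrightarrow>
       (x, Suc (Suc (Suc (Suc n)))) \<in> measure id"
    by (simp del: Suc_less_eq less_Suc_eq_le)
qed (use prod_decode_le in \<open>auto simp: less_Suc_eq_le intro!: le_trans[OF prod_decode_le(1)] le_trans[OF prod_decode_le(2)]\<close>)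

primrec encode_prog :: "prog \<Rightarrow> nat" where
  "encode_prog Zero = 0"
| "encode_prog Succ = 1"
| "encode_prog Fst = 2"
| "encode_prog Snd = 3"
| "encode_prog (Tuple f g) = 4 + 4 * prod_encode (encode_prog f, encode_prog g)"
| "encode_prog (Comp f g) = 4 + (4 * prod_encode (encode_prog f, encode_prog g) + 1)"
| "encode_prog (Prec f g) = 4 + (4 * prod_encode (encode_prog f, encode_prog g) + 2)"
| "encode_prog (Mu f) = 4 + (4 * encode_prog f + 3)"

lemma decode_prog_add_4:
  assumes "r < 4"
  shows "decode_prog (4 + (4 * m + r)) =
     (if r = 0 then Tuple (decode_prog (fst (prod_decode m))) (decode_prog (snd (prod_decode m)))
      else if r = 1 then Comp (decode_prog (fst (prod_decode m))) (decode_prog (snd (prod_decode m)))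
      else if r = 2 then Prec (decode_prog (fst (prod_decode m))) (decode_prog (snd (prod_decode m)))
      else Mu (decode_prog m))"
proof -
  have 1: "4 + (4 * m + r) = Suc (Suc (Suc (Suc (4 * m + r))))" by simp
  have 2: "(4 * m + r) div 4 = m" "(4 * m + r) mod 4 = r" using assms by auto
  show ?thesis unfolding 1 decode_prog.simps(5) 2 Let_def ..
qed

lemma decode_encode_prog: "decode_prog (encode_prog p) = p"
proof (induction p)
  case (Tuple f g)
  then show ?case
    using decode_prog_add_4[of 0 "prod_encode (encode_prog f, encode_prog g)"]
    by (simp del: decode_prog.simps)
next
  case (Comp f g)
  then show ?case
    using decode_prog_add_4[of 1 "prod_encode (encode_prog f, encode_prog g)"]
    by (simp del: decode_prog.simps)
next
  case (Prec f g)
  then show ?case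
    using decode_prog_add_4[of 2 "prod_encode (encode_prog f, encode_prog g)"]
    by (simp del: decode_prog.simps)
next
  case (Mu f)
  then show ?case
    using decode_prog_add_4[of 3 "encode_prog f"] by (simp del: decode_prog.simps)
qed (simp_all add: eval_nat_numeral)

definition W :: "nat \<Rightarrow> nat set" where
  "W e = dom (eval (decode_prog e))"

lemma range_W: "range W = {A. ce A}"
proof -
  have "dom (eval p) \<in> range W" for p
    using rangeI[of W "encode_prog p"] by (simp add: W_def decode_encode_prog)
  then show ?thesis
    by (auto simp: ce_def partial_computable_def W_def)
qed

text \<open>A family is a set of sets, given without a preferred indexing; repetitions are allowed.\<close>

definition uce :: "nat set set \<Rightarrow> bool" where
  "uce \<G> \<longleftrightarrow> (\<exists>A. ce A \<and> \<G> = range (\<lambda>i. {x. prod_encode (i, x) \<in> A}))"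


section \<open>\<open>\<Delta>\<^sup>0\<^sub>2\<close> functions\<close>

text \<open>\<open>\<Pi>\<^sup>0\<^sub>2\<close> sets are the complements of \<open>\<Sigma>\<^sup>0\<^sub>2\<close> sets, and a function is \<open>\<Delta>\<^sup>0\<^sub>2\<close> if its graph is.\<close>

definition Sigma02 :: "nat set \<Rightarrow> bool" where
  "Sigma02 A \<longleftrightarrow>
     (\<exists>R. decidable R \<and> A = {x. \<exists>a. \<forall>b. prod_encode (x, prod_encode (a, b)) \<in> R})"

definition Delta02 :: "nat set \<Rightarrow> bool" where
  "Delta02 A \<longleftrightarrow> Sigma02 A \<and> Sigma02 (- A)"

definition Delta02_fun :: "(nat \<Rightarrow> nat) \<Rightarrow> bool" where
  "Delta02_fun f \<longleftrightarrow> Delta02 (range (\<lambda>n. prod_encode (n, f n)))"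


section \<open>Behaviourally correct learning from text\<close>

text \<open>A learner may be partial; \<open>None\<close> means that its value is undefined.\<close>

type_synonym learner = "nat list \<Rightarrow> nat option"

definition computable_learner :: "learner \<Rightarrow> bool" where
  "computable_learner M \<longleftrightarrow> partial_computable (\<lambda>x. M (list_decode x))"

definition content :: "(nat \<Rightarrow> nat) \<Rightarrow> nat set" where
  "content f = {x. \<exists>n. f n = x}"

definition init_seg :: "(nat \<Rightarrow> nat) \<Rightarrow> nat \<Rightarrow> nat list" where
  "init_seg f i = map f [0..<i]"

definition TxtBC_identifies :: "learner \<Rightarrow> (nat \<Rightarrow> nat) \<Rightarrow> bool" where
  "TxtBC_identifies M f \<longleftrightarrow>
     (\<exists>n. \<forall>i>n. \<exists>e. M (init_seg f i) = Some e \<and> W e = content f)"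

definition TxtBC_learns :: "learner \<Rightarrow> nat set \<Rightarrow> bool" where
  "TxtBC_learns M A \<longleftrightarrow> (\<forall>f. content f = A \<longrightarrow> TxtBC_identifies M f)"

definition TxtBC_learnable :: "nat set set \<Rightarrow> bool" where
  "TxtBC_learnable \<G> \<longleftrightarrow> (\<exists>M. computable_learner M \<and> (\<forall>A\<in>\<G>. TxtBC_learns M A))"

end

(*
  Fix M and a c.e. set A in the family, and write H(r) for the set named by M on the string r
  (empty if M diverges). Call s locking for A if H(r) = A for every extension r of s by elements
  of A. If some string over A has no locking extension, a text for A on which M is infinitely often
  wrong is found by repeatedly searching for an extension r with H(r) different from A; since A is
  c.e., "H(r) differs from A" is a Sigma_2 condition, so the search is computable in the halting
  problem and the text is Delta_2.

  Otherwise every string over A has a locking extension, for all A in the family. A learner that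
  succeeds on all texts then conjectures, from data with code l, the set of all x such that for some
  string k < l over the data, x lies in H(r) for all extensions r < l of k over the data, and
  each string j < k over the data has an extension r < l over the data with x in H(r).
*)
theory Submission
  imports Defs "HOL-Library.Sublist"
begin

section \<open>Computable functions and decidable predicates\<close>

abbreviation pfst :: "nat \<Rightarrow> nat" where "pfst x \<equiv> fst (prod_decode x)"
abbreviation psnd :: "nat \<Rightarrow> nat" where "psnd x \<equiv> snd (prod_decode x)"

abbreviation computable :: "(nat \<Rightarrow> nat) \<Rightarrow> bool" where
  "computable f \<equiv> partial_computable (\<lambda>x. Some (f x))"

named_theorems computable_intros

lemma computableI: "(\<And>x. eval p x = Some (f x)) \<Longrightarrow> computable f"
  unfolding partial_computable_def by (intro exI[of _ p]) auto

lemma computableE: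
  assumes "computable f"
  obtains p where "\<And>x. eval p x = Some (f x)"
proof -
  obtain p where p: "(\<lambda>x. Some (f x)) = eval p"
    using assms unfolding partial_computable_def ..
  show thesis by (rule that[of p]) (simp flip: p)
qed

lemma decidable_Collect: "decidable {x. P x} \<longleftrightarrow> computable (\<lambda>x. if P x then 1 else 0)"
  by (simp add: decidable_def)

text \<open>The identity is not an initial function, but every number codes a pair, so pairing the
  two projections recovers it.\<close>

lemma computable_id [computable_intros]: "computable (\<lambda>x. x)"
  by (rule computableI[of "Tuple Fst Snd"]) simp

primrec const_prog :: "nat \<Rightarrow> prog" where
  "const_prog 0 = Zero"
| "const_prog (Suc n) = Comp Succ (const_prog n)"

lemma eval_const_prog [simp]: "eval (const_prog n) x = Some n"
  by (induction n) auto

lemma computable_const [computable_intros]: "computable (\<lambda>x. c)"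
  by (rule computableI[of "const_prog c"]) simp

lemma computable_comp:
  assumes "computable f" "computable g"
  shows "computable (\<lambda>x. f (g x))"
proof -
  obtain p q where "\<And>x. eval p x = Some (f x)" "\<And>x. eval q x = Some (g x)"
    using assms by (metis computableE)
  then show ?thesis
    by (intro computableI[of "Comp p q"]) simp
qed

lemma computable_Suc [computable_intros]: "computable f \<Longrightarrow> computable (\<lambda>x. Suc (f x))"
  by (rule computable_comp[of Suc]) (rule computableI[of Succ], simp_all)

lemma computable_pfst [computable_intros]: "computable f \<Longrightarrow> computable (\<lambda>x. pfst (f x))"
  by (rule computable_comp[of pfst]) (rule computableI[of Fst], simp_all)

lemma computable_psnd [computable_intros]: "computable f \<Longrightarrow> computable (\<lambda>x. psnd (f x))"
  by (rule computable_comp[of psnd]) (rule computableI[of Snd], simp_all)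

lemma computable_pair [computable_intros]:
  assumes "computable f" "computable g"
  shows "computable (\<lambda>x. prod_encode (f x, g x))"
proof -
  obtain p q where "\<And>x. eval p x = Some (f x)" "\<And>x. eval q x = Some (g x)"
    using assms by (metis computableE)
  then show ?thesis
    by (intro computableI[of "Tuple p q"]) simp
qed

lemma computable_comp2:
  assumes "computable (\<lambda>z. h (pfst z) (psnd z))" "computable f" "computable g"
  shows "computable (\<lambda>x. h (f x) (g x))"
  using computable_comp[OF assms(1) computable_pair[OF assms(2,3)]] by simp

text \<open>Taking the whole input x as the parameter of \<open>Prec\<close> lets the step function
  depend on it, while the length of the recursion is computed separately.\<close>

lemma computable_rec_nat [computable_intros]:
  assumes "computable a" "computable (\<lambda>z. g (pfst z) (pfst (psnd z)) (psnd (psnd z)))" "computable n"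
  shows "computable (\<lambda>x. rec_nat (a x) (\<lambda>k r. g x k r) (n x))"
proof -
  obtain p where p: "\<And>x. eval p x = Some (a x)" using assms(1) by (metis computableE)
  obtain q where q: "\<And>z. eval q z = Some (g (pfst z) (pfst (psnd z)) (psnd (psnd z)))"
    using computableE[OF assms(2)] by blast
  obtain m where m: "\<And>x. eval m x = Some (n x)" using assms(3) by (metis computableE)
  have "rec_nat (Some (a x))
      (\<lambda>k r. Option.bind r (\<lambda>v. eval q (prod_encode (x, prod_encode (k, v))))) i
    = Some (rec_nat (a x) (\<lambda>k r. g x k r) i)" for x i
    by (induction i) (simp_all add: q)
  then show ?thesis
    by (intro computableI[of "Comp (Prec p q) (Tuple (Tuple Fst Snd) m)"]) (simp add: p m)
qed

section \<open>Case distinctions and decidable predicates\<close>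

lemma computable_if [computable_intros]:
  assumes "decidable {x. P x}" "computable f" "computable g"
  shows "computable (\<lambda>x. if P x then f x else g x)"
proof -
  \<comment> \<open>A recursion of length zero yields \<open>g x\<close>; one step discards it for
    \<open>f x\<close>.\<close>
  have "computable (\<lambda>x. rec_nat (g x) (\<lambda>_ _. f x) (if P x then 1 else 0))"
    by (intro computable_intros computable_comp[OF assms(2)] assms
        assms(1)[unfolded decidable_Collect])
  also have "(\<lambda>x. rec_nat (g x) (\<lambda>_ _. f x) (if P x then 1 else 0))
      = (\<lambda>x. if P x then f x else g x)"
    by auto
  finally show ?thesis .
qed

lemma decidable_not [computable_intros]:
  assumes "decidable {x. P x}"
  shows "decidable {x. \<not> P x}"
proof -
  have "computable (\<lambda>x. if P x then 0 else 1)"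
    by (intro computable_intros assms)
  also have "(\<lambda>x. if P x then 0 else 1) = (\<lambda>x. if \<not> P x then 1 else 0 :: nat)" by auto
  finally show ?thesis unfolding decidable_Collect .
qed

lemma decidable_conj [computable_intros]:
  assumes "decidable {x. P x}" "decidable {x. Q x}"
  shows "decidable {x. P x \<and> Q x}"
proof -
  have "computable (\<lambda>x. if P x then if Q x then 1 else 0 else 0)"
    by (intro computable_intros assms)
  also have "(\<lambda>x. if P x then if Q x then 1 else 0 else 0)
      = (\<lambda>x. if P x \<and> Q x then 1 else 0 :: nat)" by auto
  finally show ?thesis unfolding decidable_Collect .
qed

lemma decidable_disj [computable_intros]:
  assumes "decidable {x. P x}" "decidable {x. Q x}"
  shows "decidable {x. P x \<or> Q x}"
proof -
  have "decidable {x. \<not> (\<not> P x \<and> \<not> Q x)}"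
    by (intro computable_intros assms)
  then show ?thesis by simp
qed

lemma decidable_imp [computable_intros]:
  assumes "decidable {x. P x}" "decidable {x. Q x}"
  shows "decidable {x. P x \<longrightarrow> Q x}"
proof -
  have "decidable {x. \<not> P x \<or> Q x}"
    by (intro computable_intros assms)
  then show ?thesis by simp
qed

lemma decidable_comp:
  assumes "decidable {x. P x}" "computable f"
  shows "decidable {x. P (f x)}"
  using computable_comp[OF assms(1)[unfolded decidable_Collect] assms(2)]
  unfolding decidable_Collect .

lemma decidable_comp2:
  assumes "decidable {z. P (pfst z) (psnd z)}" "computable f" "computable g"
  shows "decidable {x. P (f x) (g x)}"
  using decidable_comp[OF assms(1) computable_pair[OF assms(2,3)]] by simp

lemma decidable_comp3:
  assumes "decidable {z. P (pfst z) (pfst (psnd z)) (psnd (psnd z))}"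
    "computable f" "computable g" "computable h"
  shows "decidable {x. P (f x) (g x) (h x)}"
  using decidable_comp[OF assms(1) computable_pair[OF assms(2) computable_pair[OF assms(3,4)]]]
  by simp

lemma decidable_ex_less [computable_intros]:
  assumes P: "decidable {z. P (pfst z) (psnd z)}" and n: "computable n"
  shows "decidable {x. \<exists>y<n x. P x y}"
proof -
  \<comment> \<open>The accumulator turns 1 at a witness and keeps its value elsewhere.\<close>
  have "computable (\<lambda>x. rec_nat 0 (\<lambda>k r. if P x k then 1 else r) (n x))"
    by (intro computable_intros decidable_comp2[OF P] n)
  moreover have "rec_nat 0 (\<lambda>k r. if P x k then 1 else r) m = (if \<exists>y<m. P x y then 1 else 0 :: nat)"
    for x m
    by (induction m) (auto simp: less_Suc_eq)
  ultimately show ?thesis unfolding decidable_Collect by simp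
qed

lemma decidable_all_less [computable_intros]:
  assumes P: "decidable {z. P (pfst z) (psnd z)}" and n: "computable n"
  shows "decidable {x. \<forall>y<n x. P x y}"
proof -
  have "decidable {x. \<not> (\<exists>y<n x. \<not> P x y)}"
    by (intro computable_intros P n)
  then show ?thesis by simp
qed

text \<open>\<open>Mu\<close> searches for a zero, so truth is coded by 0 here. All tests converge
  and a zero exists by \<open>ex\<close>, so the search is total.\<close>

lemma computable_Least [computable_intros]:
  assumes P: "decidable {z. P (pfst z) (psnd z)}" and ex: "\<And>x. \<exists>y. P x y"
  shows "computable (\<lambda>x. LEAST y. P x y)"
proof -
  have *: "computable (\<lambda>z. if P (pfst z) (psnd z) then 0 else 1)"
    by (intro computable_intros P)
  obtain p where p: "\<And>z. eval p z = Some (if P (pfst z) (psnd z) then 0 else 1)"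
    using computableE[OF *] by blast
  have "eval p (prod_encode (x, y)) = Some 0 \<longleftrightarrow> P x y"
    "eval p (prod_encode (x, y)) \<noteq> None" for x y
    using p[of "prod_encode (x, y)"] by (auto split: if_splits)
  then have "eval (Mu p) x = Some (LEAST y. P x y)" for x
    using ex[of x] by simp
  then show ?thesis by (rule computableI)
qed

section \<open>Arithmetic and comparisons\<close>

lemma computable_pred: "computable f \<Longrightarrow> computable (\<lambda>x. f x - Suc 0)"
proof (rule computable_comp[of "\<lambda>x. x - Suc 0"])
  \<comment> \<open>The step returns its counter instead of the previous value.\<close>
  have "computable (\<lambda>x. rec_nat 0 (\<lambda>k _. k) x)"
    by (intro computable_intros)
  moreover have "rec_nat 0 (\<lambda>k _. k) x = x - Suc 0" for x
    by (cases x) auto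
  ultimately show "computable (\<lambda>x. x - Suc 0)" by simp
qed

lemma computable_diff [computable_intros]:
  assumes "computable f" "computable g"
  shows "computable (\<lambda>x. f x - g x)"
proof -
  have "computable (\<lambda>x. rec_nat (f x) (\<lambda>_ r. r - Suc 0) (g x))"
    by (intro computable_intros computable_pred assms)
  moreover have "rec_nat m (\<lambda>_ r. r - Suc 0) n = m - n" for m n
    by (induction n) auto
  ultimately show ?thesis by simp
qed

lemma computable_add [computable_intros]:
  assumes "computable f" "computable g"
  shows "computable (\<lambda>x. f x + g x)"
proof -
  have "computable (\<lambda>x. rec_nat (f x) (\<lambda>_ r. Suc r) (g x))"
    by (intro computable_intros assms)
  moreover have "rec_nat m (\<lambda>_ r. Suc r) n = m + n" for m n
    by (induction n) auto
  ultimately show ?thesis by simp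
qed

lemma computable_mult [computable_intros]:
  assumes "computable f" "computable g"
  shows "computable (\<lambda>x. f x * g x)"
proof -
  have "computable (\<lambda>x. rec_nat 0 (\<lambda>_ r. r + f x) (g x))"
    by (intro computable_intros computable_comp[OF assms(1)] assms)
  moreover have "rec_nat 0 (\<lambda>_ r. r + m) n = m * n" for m n :: nat
    by (induction n) auto
  ultimately show ?thesis by simp
qed

lemma decidable_le [computable_intros]:
  assumes "computable f" "computable g"
  shows "decidable {x. f x \<le> g x}"
proof -
  have "computable (\<lambda>x. 1 - (f x - g x))"
    by (intro computable_intros assms)
  also have "(\<lambda>x. 1 - (f x - g x)) = (\<lambda>x. if f x \<le> g x then 1 else 0)" by auto
  finally show ?thesis unfolding decidable_Collect .
qed

lemma decidable_eq [computable_intros]: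
  assumes "computable f" "computable g"
  shows "decidable {x. f x = g x}"
  using decidable_conj[OF decidable_le[OF assms] decidable_le[OF assms(2,1)]]
  unfolding order_eq_iff[symmetric] .

section \<open>Coded lists\<close>

text \<open>A nonempty list is coded as the successor of the pair of its head and the code of its
  tail. The tail step also fixes 0, the code of the empty list, so dropping beyond the end gives
  0.\<close>

definition ldrop :: "nat \<Rightarrow> nat \<Rightarrow> nat" where
  "ldrop i l = rec_nat l (\<lambda>_ r. psnd (r - Suc 0)) i"

definition lhd :: "nat \<Rightarrow> nat" where
  "lhd l = pfst (l - Suc 0)"

lemma computable_ldrop [computable_intros]:
  "computable f \<Longrightarrow> computable g \<Longrightarrow> computable (\<lambda>x. ldrop (f x) (g x))"
  unfolding ldrop_def by (intro computable_intros)

lemma computable_lhd [computable_intros]: "computable f \<Longrightarrow> computable (\<lambda>x. lhd (f x))"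
  unfolding lhd_def by (intro computable_intros)

lemma prod_decode_0 [simp]: "prod_decode 0 = (0, 0)"
  using prod_encode_inverse[of "(0, 0)"] by (simp add: prod_encode_def)

lemma ldrop_list_encode: "ldrop i (list_encode xs) = list_encode (drop i xs)"
proof (induction i)
  case (Suc i)
  have "psnd (list_encode ys - Suc 0) = list_encode (tl ys)" for ys
    by (cases ys) auto
  with Suc show ?case by (simp add: ldrop_def drop_Suc tl_drop)
qed (simp add: ldrop_def)

lemma list_encode_0_iff [simp]: "list_encode xs = 0 \<longleftrightarrow> xs = []"
  by (cases xs) auto

lemma ldrop_eq_0_iff: "ldrop i l = 0 \<longleftrightarrow> length (list_decode l) \<le> i"
  using ldrop_list_encode[of i "list_decode l"] by simp

lemma lhd_ldrop:
  assumes "i < length (list_decode l)"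
  shows "lhd (ldrop i l) = list_decode l ! i"
proof -
  have "lhd (list_encode ys) = hd ys" if "ys \<noteq> []" for ys
    using that by (cases ys) (auto simp: lhd_def)
  then show ?thesis
    using assms ldrop_list_encode[of i "list_decode l"] by (simp add: hd_drop_conv_nth)
qed

lemma length_le_list_encode: "length xs \<le> list_encode xs"
  by (induction xs) (auto intro: le_trans[OF _ le_prod_encode_2])

lemma mem_less_list_encode: "x \<in> set xs \<Longrightarrow> x < list_encode xs"
proof (induction xs)
  case (Cons a xs)
  then show ?case
    using le_prod_encode_1[of a "list_encode xs"] le_prod_encode_2[of "list_encode xs" a]
    by auto
qed simp

text \<open>The code bounds the length, so positions can range below \<open>l\<close> itself, and
  \<open>ldrop i l \<noteq> 0\<close> discards those beyond the end. The quantifier is thus bounded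
  by a computable term.\<close>

lemma mem_list_decode_iff:
  "x \<in> set (list_decode l) \<longleftrightarrow> (\<exists>i<l. ldrop i l \<noteq> 0 \<and> lhd (ldrop i l) = x)"
  using length_le_list_encode[of "list_decode l"]
  by (force simp: in_set_conv_nth ldrop_eq_0_iff not_le lhd_ldrop)

lemma decidable_mem_list_decode [computable_intros]:
  assumes "computable f" "computable g"
  shows "decidable {x. f x \<in> set (list_decode (g x))}"
  unfolding mem_list_decode_iff
  by (intro computable_intros computable_comp[OF assms(1)] computable_comp[OF assms(2)] assms)

lemma prefix_conv_nth:
  "prefix xs ys \<longleftrightarrow> length xs \<le> length ys \<and> (\<forall>i<length xs. ys ! i = xs ! i)"
proof
  assume "length xs \<le> length ys \<and> (\<forall>i<length xs. ys ! i = xs ! i)"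
  then have "take (length xs) ys = xs" by (intro nth_equalityI) auto
  then show "prefix xs ys" by (metis take_is_prefix)
qed (auto simp: prefix_def nth_append)

lemma prefix_list_decode_iff:
  "prefix (list_decode k) (list_decode l) \<longleftrightarrow>
    (\<forall>i<k. ldrop i k \<noteq> 0 \<longrightarrow> ldrop i l \<noteq> 0 \<and> lhd (ldrop i l) = lhd (ldrop i k))"
proof -
  have "prefix xs ys \<longleftrightarrow> (\<forall>i<length xs. i < length ys \<and> ys ! i = xs ! i)" for xs ys :: "nat list"
    unfolding prefix_conv_nth by (metis dual_order.strict_trans1 not_le order.irrefl)
  then show ?thesis
    using length_le_list_encode[of "list_decode k"]
    by (auto simp: ldrop_eq_0_iff not_le lhd_ldrop) (metis lhd_ldrop less_le_trans)
qed

lemma decidable_prefix_list_decode [computable_intros]: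
  assumes "computable f" "computable g"
  shows "decidable {x. prefix (list_decode (f x)) (list_decode (g x))}"
  unfolding prefix_list_decode_iff
  by (intro computable_intros computable_comp[OF assms(1)] computable_comp[OF assms(2)] assms)

lemma decidable_Ball_list_decode [computable_intros]:
  assumes P: "decidable {z. P (pfst z) (psnd z)}" and f: "computable f"
  shows "decidable {x. \<forall>y\<in>set (list_decode (f x)). P x y}"
proof -
  \<comment> \<open>Entries are smaller than the code of their list.\<close>
  have *: "(\<forall>y\<in>set (list_decode l). P x y) \<longleftrightarrow> (\<forall>y<l. y \<in> set (list_decode l) \<longrightarrow> P x y)" for x l
    using mem_less_list_encode[of _ "list_decode l"] by auto
  show ?thesis
    unfolding * by (intro computable_intros P f computable_comp[OF f])
qed

lemma decidable_less_length_list_decode [computable_intros]: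
  assumes "computable f" "computable g"
  shows "decidable {x. f x < length (list_decode (g x))}"
proof -
  have "decidable {x. ldrop (f x) (g x) \<noteq> 0}"
    by (intro computable_intros assms)
  then show ?thesis by (simp add: ldrop_eq_0_iff not_le)
qed

section \<open>A computable enumeration of all halting computations\<close>

text \<open>\<open>T e x y\<close> means that program \<open>e\<close> is already known to return \<open>y\<close> on input \<open>x\<close>.\<close>

inductive infer :: "(nat \<Rightarrow> nat \<Rightarrow> nat \<Rightarrow> bool) \<Rightarrow> nat \<Rightarrow> nat \<Rightarrow> nat \<Rightarrow> bool" for T where
  Zero: "infer T 0 x 0"
| Succ: "infer T 1 x (Suc x)"
| Fst: "infer T 2 x (pfst x)"
| Snd: "infer T 3 x (psnd x)"
| Tuple: "T (pfst m) x u \<Longrightarrow> T (psnd m) x v \<Longrightarrow> infer T (4 + (4 * m + 0)) x (prod_encode (u, v))"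
| Comp: "T (psnd m) x u \<Longrightarrow> T (pfst m) u y \<Longrightarrow> infer T (4 + (4 * m + 1)) x y"
| Prec_0: "T (pfst m) a y \<Longrightarrow> infer T (4 + (4 * m + 2)) (prod_encode (a, 0)) y"
| Prec_Suc: "T (4 + (4 * m + 2)) (prod_encode (a, k)) v \<Longrightarrow>
    T (psnd m) (prod_encode (a, prod_encode (k, v))) y \<Longrightarrow>
    infer T (4 + (4 * m + 2)) (prod_encode (a, Suc k)) y"
| Mu: "T m (prod_encode (x, y)) 0 \<Longrightarrow> (\<And>k. k < y \<Longrightarrow> \<exists>v. T m (prod_encode (x, k)) (Suc v)) \<Longrightarrow>
    infer T (4 + (4 * m + 3)) x y"

lemma infer_mono:
  assumes "infer T e x y" "\<And>e x y. T e x y \<Longrightarrow> T' e x y"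
  shows "infer T' e x y"
  using assms(1) by (induction rule: infer.induct) (rule infer.intros; use assms(2) in blast)+

text \<open>Each rule preserves the truth of a table; induction on the stages then makes everything
  derived true.\<close>

lemma infer_sound:
  assumes "infer T e x y" and T: "\<And>e x y. T e x y \<Longrightarrow> eval (decode_prog e) x = Some y"
  shows "eval (decode_prog e) x = Some y"
proof -
  note dec = decode_prog_add_4[of 0] decode_prog_add_4[of 1] decode_prog_add_4[of 2]
    decode_prog_add_4[of 3]
  show ?thesis using assms(1)
  proof cases
    case (Tuple m u v)
    then show ?thesis using dec(1)[of m] by (simp add: T del: decode_prog.simps)
  next
    case (Comp m u)
    then show ?thesis using dec(2)[of m] by (simp add: T del: decode_prog.simps)
  next
    case (Prec_0 m a)
    then show ?thesis using dec(3)[of m] by (simp add: T del: decode_prog.simps)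
  next
    case (Prec_Suc m a k v)
    from Prec_Suc show ?thesis
      using dec(3)[of m] T[OF Prec_Suc(3)] T[OF Prec_Suc(4)] by (simp del: decode_prog.simps)
  next
    case (Mu m)
    have zero: "eval (decode_prog m) (prod_encode (x, y)) = Some 0"
      using Mu T by blast
    have pos: "\<exists>v. eval (decode_prog m) (prod_encode (x, k)) = Some (Suc v)" if "k < y" for k
      using Mu T that by blast
    \<comment> \<open>The nonzero values below y make y the least zero, and they witness the
      convergence that \<open>Mu\<close> demands.\<close>
    have "(LEAST n. eval (decode_prog m) (prod_encode (x, n)) = Some 0) = y"
      by (rule Least_equality) (use zero pos in \<open>force simp: not_le[symmetric]\<close>)+
    moreover have "\<exists>n. eval (decode_prog m) (prod_encode (x, n)) = Some 0 \<and>
        (\<forall>k<n. eval (decode_prog m) (prod_encode (x, k)) \<noteq> None)"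
      using zero pos by (metis option.distinct(1))
    ultimately show ?thesis
      using dec(4)[of m] Mu(1) by (simp del: decode_prog.simps)
  qed (simp_all add: eval_nat_numeral)
qed

definition triple_in :: "nat \<Rightarrow> nat \<Rightarrow> nat \<Rightarrow> nat \<Rightarrow> bool" where
  "triple_in S e x y \<longleftrightarrow> prod_encode (e, prod_encode (x, y)) \<in> set (list_decode S)"

lemma triple_in_bound: "triple_in S e x y \<Longrightarrow> y < S"
  unfolding triple_in_def
  using mem_less_list_encode[of "prod_encode (e, prod_encode (x, y))" "list_decode S"]
    le_prod_encode_2[of "prod_encode (x, y)" e] le_prod_encode_2[of y x] by simp

text \<open>Only bounded quantifiers occur in this form, so decidability follows: m is below the
  index built from it, and intermediate results found in the table are below its code.\<close>

lemma infer_triple_in_iff: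
  "infer (triple_in S) e x y \<longleftrightarrow>
     e = 0 \<and> y = 0 \<or> e = 1 \<and> y = Suc x \<or> e = 2 \<and> y = pfst x \<or> e = 3 \<and> y = psnd x \<or>
     (\<exists>m<e. e = 4 + (4 * m + 0) \<and> triple_in S (pfst m) x (pfst y) \<and> triple_in S (psnd m) x (psnd y)) \<or>
     (\<exists>m<e. e = 4 + (4 * m + 1) \<and> (\<exists>u<S. triple_in S (psnd m) x u \<and> triple_in S (pfst m) u y)) \<or>
     (\<exists>m<e. e = 4 + (4 * m + 2) \<and> psnd x = 0 \<and> triple_in S (pfst m) (pfst x) y) \<or>
     (\<exists>m<e. e = 4 + (4 * m + 2) \<and> (\<exists>k<psnd x. \<exists>v<S. psnd x = Suc k \<and>
        triple_in S e (prod_encode (pfst x, k)) v \<and>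
        triple_in S (psnd m) (prod_encode (pfst x, prod_encode (k, v))) y)) \<or>
     (\<exists>m<e. e = 4 + (4 * m + 3) \<and> triple_in S m (prod_encode (x, y)) 0 \<and>
        (\<forall>k<y. \<exists>v<S. triple_in S m (prod_encode (x, k)) (Suc v)))"
    (is "_ \<longleftrightarrow> ?base \<or> ?b2 \<or> ?b3 \<or> ?b4 \<or> ?tuple \<or> ?comp \<or> ?prec0 \<or> ?precS \<or> ?mu")
proof
  assume "infer (triple_in S) e x y"
  then show "?base \<or> ?b2 \<or> ?b3 \<or> ?b4 \<or> ?tuple \<or> ?comp \<or> ?prec0 \<or> ?precS \<or> ?mu"
  proof cases
    case (Tuple m u v)
    then have ?tuple by (intro exI[of _ m]) auto
    then show ?thesis by blast
  next
    case (Comp m u)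
    then have ?comp by (intro exI[of _ m]) (auto dest: triple_in_bound)
    then show ?thesis by blast
  next
    case (Prec_0 m a)
    then have ?prec0 by (intro exI[of _ m]) auto
    then show ?thesis by blast
  next
    case (Prec_Suc m a k v)
    then have ?precS by (intro exI[of _ m]) (auto dest: triple_in_bound)
    then show ?thesis by blast
  next
    case (Mu m)
    have "\<exists>v<S. triple_in S m (prod_encode (x, k)) (Suc v)" if "k < y" for k
      using Mu(3)[OF that] triple_in_bound Suc_lessD by blast
    with Mu have ?mu by (intro exI[of _ m]) auto
    then show ?thesis by blast
  qed auto
next
  have x: "x = prod_encode (pfst x, psnd x)" and y: "y = prod_encode (pfst y, psnd y)" by simp_all
  assume "?base \<or> ?b2 \<or> ?b3 \<or> ?b4 \<or> ?tuple \<or> ?comp \<or> ?prec0 \<or> ?precS \<or> ?mu"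
  then show "infer (triple_in S) e x y"
  proof (elim disjE)
    assume ?tuple
    then show ?thesis using infer.Tuple[of "triple_in S"] y by metis
  next
    assume ?comp
    then show ?thesis using infer.Comp[of "triple_in S"] by blast
  next
    assume ?prec0
    then show ?thesis using infer.Prec_0[of "triple_in S"] x by metis
  next
    assume ?precS
    then show ?thesis using infer.Prec_Suc[of "triple_in S"] x by metis
  next
    assume ?mu
    then show ?thesis using infer.Mu[of "triple_in S"] by blast
  qed (use infer.intros(1-4) in \<open>metis+\<close>)
qed

text \<open>
  Step \<open>t\<close> examines the triple coded by \<open>pfst t\<close>, so every triple is examined infinitely often.
\<close>

definition derived :: "nat \<Rightarrow> nat" where
  "derived t = rec_nat 0
     (\<lambda>t S. if infer (triple_in S) (pfst (pfst t)) (pfst (psnd (pfst t))) (psnd (psnd (pfst t)))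
            then Suc (prod_encode (pfst t, S)) else S) t"

lemma decidable_triple_in [computable_intros]:
  "computable s \<Longrightarrow> computable f \<Longrightarrow> computable g \<Longrightarrow> computable h \<Longrightarrow>
   decidable {z. triple_in (s z) (f z) (g z) (h z)}"
  unfolding triple_in_def by (intro computable_intros)

lemma decidable_infer [computable_intros]:
  assumes "computable s" "computable f" "computable g" "computable h"
  shows "decidable {z. infer (triple_in (s z)) (f z) (g z) (h z)}"
proof -
  have "decidable {z. infer (triple_in (pfst z)) (pfst (psnd z)) (pfst (psnd (psnd z)))
      (psnd (psnd (psnd z)))}"
    unfolding infer_triple_in_iff by (intro computable_intros)
  from decidable_comp[OF this, of "\<lambda>z. prod_encode (s z, prod_encode (f z, prod_encode (g z, h z)))"]
  show ?thesis
    using assms by (simp add: computable_intros)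
qed

lemma computable_derived [computable_intros]: "computable f \<Longrightarrow> computable (\<lambda>x. derived (f x))"
  unfolding derived_def by (intro computable_intros)

definition returns_by :: "nat \<Rightarrow> nat \<Rightarrow> nat \<Rightarrow> nat \<Rightarrow> bool" where
  "returns_by t e x y \<longleftrightarrow> triple_in (derived t) e x y"

lemma decidable_returns_by [computable_intros]:
  "computable s \<Longrightarrow> computable f \<Longrightarrow> computable g \<Longrightarrow> computable h \<Longrightarrow>
   decidable {z. returns_by (s z) (f z) (g z) (h z)}"
  unfolding returns_by_def by (intro computable_intros)

lemma returns_by_0: "\<not> returns_by 0 e x y"
  by (simp add: returns_by_def triple_in_def derived_def)

lemma returns_by_Suc:
  "returns_by (Suc t) e x y \<longleftrightarrow> returns_by t e x y \<or>
     pfst t = prod_encode (e, prod_encode (x, y)) \<and> infer (returns_by t) e x y"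
proof -
  obtain e' x' y' where t: "pfst t = prod_encode (e', prod_encode (x', y'))"
    by (metis surj_pair prod_decode_inverse)
  have eq: "returns_by t = triple_in (derived t)"
    by (intro ext) (rule returns_by_def)
  have "derived (Suc t) =
      (if infer (triple_in (derived t)) e' x' y' then Suc (prod_encode (pfst t, derived t))
       else derived t)"
    by (simp add: derived_def t)
  then show ?thesis
    by (auto simp: triple_in_def t returns_by_def eq)
qed

lemma returns_by_mono:
  assumes "returns_by s e x y" "s \<le> t"
  shows "returns_by t e x y"
  using assms(2,1) by (induction rule: dec_induct) (auto simp: returns_by_Suc)

lemma returns_by_sound: "returns_by t e x y \<Longrightarrow> eval (decode_prog e) x = Some y"
proof (induction t arbitrary: e x y)
  case (Suc t)
  then show ?case
    using infer_sound[of "returns_by t"] by (auto simp: returns_by_Suc)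
qed (simp add: returns_by_0)

text \<open>The stage s is chosen to examine precisely this triple, and s \<ge> t since a pair is at
  least its second component. By monotonicity the rule still applies there.\<close>

lemma returns_by_infer:
  assumes "infer (returns_by t) e x y"
  shows "\<exists>t. returns_by t e x y"
proof -
  define s where "s = prod_encode (prod_encode (e, prod_encode (x, y)), t)"
  have "infer (returns_by s) e x y"
    using assms by (rule infer_mono) (simp add: returns_by_mono s_def le_prod_encode_2)
  then have "returns_by (Suc s) e x y"
    by (simp add: returns_by_Suc s_def)
  then show ?thesis ..
qed

text \<open>The maximum of finitely many stages serves all of them, as truth persists. This moves a
  bounded universal quantifier past the search for a stage.\<close>

lemma ex_common_stage:
  fixes P :: "nat \<Rightarrow> nat \<Rightarrow> bool"
  assumes "\<And>i s t. P i s \<Longrightarrow> s \<le> t \<Longrightarrow> P i t"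
  shows "(\<forall>i<n. \<exists>t. P i t) \<longleftrightarrow> (\<exists>t. \<forall>i<n. P i t)"
proof (induction n)
  case (Suc n)
  have "\<exists>t. \<forall>i<Suc n. P i t" if "\<forall>i<n. P i s" "P n t" for s t
    using that assms[OF _ max.cobounded1[of s t]] assms[OF _ max.cobounded2[of t s]]
    by (intro exI[of _ "max s t"]) (auto simp: less_Suc_eq)
  with Suc show ?case by (metis less_Suc_eq)
qed simp

text \<open>Induction on the program: the rule for its outermost constructor applies at a stage by
  which the required subcomputations are known.\<close>

lemma returns_by_complete: "eval p x = Some y \<Longrightarrow> \<exists>t. returns_by t (encode_prog p) x y"
proof (induction p arbitrary: x y)
  case Zero
  then show ?case using returns_by_infer[OF infer.Zero] by simp
next
  case Succ
  then show ?case using returns_by_infer[OF infer.Succ[of _ x]] by auto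
next
  case Fst
  then show ?case using returns_by_infer[OF infer.Fst[of _ x]] by auto
next
  case Snd
  then show ?case using returns_by_infer[OF infer.Snd[of _ x]] by auto
next
  case (Tuple f g)
  from Tuple.prems obtain u v where y: "y = prod_encode (u, v)"
    and "eval f x = Some u" "eval g x = Some v"
    by (auto simp: Option.bind_eq_Some_conv)
  with Tuple.IH obtain s t where "returns_by s (encode_prog f) x u" "returns_by t (encode_prog g) x v"
    by blast
  then have "returns_by (max s t) (encode_prog f) x u" "returns_by (max s t) (encode_prog g) x v"
    by (auto elim: returns_by_mono)
  then show ?case
    using returns_by_infer[OF infer.Tuple[of _ "prod_encode (encode_prog f, encode_prog g)"]]
    by (simp add: y)
next
  case (Comp f g)
  from Comp.prems obtain u where "eval g x = Some u" "eval f u = Some y"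
    by (auto simp: Option.bind_eq_Some_conv)
  with Comp.IH obtain s t where "returns_by s (encode_prog g) x u" "returns_by t (encode_prog f) u y"
    by blast
  then have "returns_by (max s t) (encode_prog g) x u" "returns_by (max s t) (encode_prog f) u y"
    by (auto elim: returns_by_mono)
  then show ?case
    using returns_by_infer[OF infer.Comp[of _ "prod_encode (encode_prog f, encode_prog g)"]]
    by simp
next
  case (Prec f g)
  define m where "m = prod_encode (encode_prog f, encode_prog g)"
  have e: "encode_prog (Prec f g) = 4 + (4 * m + 2)" by (simp add: m_def)
  \<comment> \<open>Inner induction on the recursion counter: earlier values of the recursion are
    facts about the same index.\<close>
  have "\<exists>t. returns_by t (4 + (4 * m + 2)) (prod_encode (a, n)) y"
    if "eval (Prec f g) (prod_encode (a, n)) = Some y" for a n y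
    using that
  proof (induction n arbitrary: y)
    case 0
    then obtain t where "returns_by t (pfst m) a y" using Prec.IH(1) by (auto simp: m_def)
    then show ?case by (rule returns_by_infer[OF infer.Prec_0])
  next
    case (Suc n)
    then obtain v where "eval (Prec f g) (prod_encode (a, n)) = Some v"
      and "eval g (prod_encode (a, prod_encode (n, v))) = Some y"
      by (auto simp: Option.bind_eq_Some_conv)
    with Suc.IH Prec.IH(2) obtain s t where "returns_by s (4 + (4 * m + 2)) (prod_encode (a, n)) v"
      and "returns_by t (encode_prog g) (prod_encode (a, prod_encode (n, v))) y"
      by blast
    then have "returns_by (max s t) (4 + (4 * m + 2)) (prod_encode (a, n)) v"
      and "returns_by (max s t) (psnd m) (prod_encode (a, prod_encode (n, v))) y"
      by (auto simp: m_def intro: returns_by_mono)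
    then show ?case by (rule returns_by_infer[OF infer.Prec_Suc])
  qed
  from this[of "pfst x" "psnd x" y] Prec.prems show ?case unfolding e by simp
next
  case (Mu f)
  define Z where "Z = (\<lambda>n. eval f (prod_encode (x, n)) = Some 0)"
  from Mu.prems obtain n where n: "Z n" "\<forall>k<n. eval f (prod_encode (x, k)) \<noteq> None"
    and y: "y = (LEAST n. Z n)"
    by (auto simp: Z_def split: if_splits)
  have "Z y" unfolding y using n(1) by (rule LeastI)
  have "y \<le> n" unfolding y using n(1) by (rule Least_le)
  have pos: "\<exists>v. eval f (prod_encode (x, k)) = Some (Suc v)" if "k < y" for k
  proof -
    have "\<not> Z k" using not_less_Least that y by blast
    moreover have "eval f (prod_encode (x, k)) \<noteq> None"
      using n(2) less_le_trans[OF that \<open>y \<le> n\<close>] by blast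
    ultimately show ?thesis
      by (auto simp: Z_def gr0_conv_Suc)
  qed
  from \<open>Z y\<close> Mu.IH obtain s where s: "returns_by s (encode_prog f) (prod_encode (x, y)) 0"
    unfolding Z_def by blast
  \<comment> \<open>Only finitely many tests precede y, so one stage knows them all.\<close>
  have "\<forall>k<y. \<exists>t. \<exists>v. returns_by t (encode_prog f) (prod_encode (x, k)) (Suc v)"
    using pos Mu.IH by blast
  then obtain t where t: "\<forall>k<y. \<exists>v. returns_by t (encode_prog f) (prod_encode (x, k)) (Suc v)"
    by (subst (asm) ex_common_stage) (auto intro: returns_by_mono)
  have "infer (returns_by (max s t)) (4 + (4 * encode_prog f + 3)) x y"
    using s t by (intro infer.Mu) (blast intro: returns_by_mono max.cobounded1 max.cobounded2)+
  then show ?case using returns_by_infer by simp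
qed

text \<open>With this, completeness, which is stated for codes of programs, covers all
  indices.\<close>

lemma encode_decode_prog: "encode_prog (decode_prog e) = e"
proof (induction e rule: decode_prog.induct)
  case (5 n)
  have "n mod 4 < 4" by simp
  then consider "n mod 4 = 0" | "n mod 4 = 1" | "n mod 4 = 2" | "n mod 4 = 3" by linarith
  then show ?case
    using 5[OF refl refl refl refl] div_mult_mod_eq[of n 4]
    by cases (simp_all add: Let_def)
qed simp_all

theorem returns_by_iff: "(\<exists>t. returns_by t e x y) \<longleftrightarrow> eval (decode_prog e) x = Some y"
  using returns_by_sound returns_by_complete[of "decode_prog e"]
  by (auto simp: encode_decode_prog)

section \<open>Stagewise enumeration of the c.e. sets, and uniform indices\<close>

definition W_by :: "nat \<Rightarrow> nat \<Rightarrow> nat \<Rightarrow> bool" where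
  "W_by t e x \<longleftrightarrow> (\<exists>y<derived t. returns_by t e x y)"

text \<open>The bound \<open>derived t\<close> makes \<open>W_by\<close> decidable and loses
  nothing, since outputs in a table lie below its code.\<close>

lemma W_by_iff: "W_by t e x \<longleftrightarrow> (\<exists>y. returns_by t e x y)"
  by (auto simp: W_by_def returns_by_def dest: triple_in_bound)

lemma W_by_mono: "W_by s e x \<Longrightarrow> s \<le> t \<Longrightarrow> W_by t e x"
  unfolding W_by_iff by (blast intro: returns_by_mono)

lemma decidable_W_by [computable_intros]:
  assumes "computable s" "computable f" "computable g"
  shows "decidable {z. W_by (s z) (f z) (g z)}"
  unfolding W_by_def by (intro computable_intros assms assms[THEN computable_comp])

lemma mem_W_iff: "x \<in> W e \<longleftrightarrow> (\<exists>t. W_by t e x)"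
proof -
  have "x \<in> W e \<longleftrightarrow> (\<exists>y t. returns_by t e x y)"
    unfolding returns_by_iff by (auto simp: W_def)
  then show ?thesis unfolding W_by_iff by blast
qed

text \<open>The code arises by iterating the \<open>Comp\<close> clause of
  \<open>encode_prog\<close>; the 1 in the recursion is the code of \<open>Succ\<close>.\<close>

lemma computable_encode_const_prog [computable_intros]:
  "computable f \<Longrightarrow> computable (\<lambda>x. encode_prog (const_prog (f x)))"
proof -
  have "encode_prog (const_prog n) = rec_nat 0 (\<lambda>_ r. 4 + (4 * prod_encode (1, r) + 1)) n" for n
    by (induction n) auto
  then show "computable f \<Longrightarrow> computable (\<lambda>x. encode_prog (const_prog (f x)))"
    by (simp only:) (intro computable_intros)
qed

text \<open>An instance of the s-m-n theorem: l is hard-wired by a constant program, whose code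
  depends computably on l, and \<open>Mu\<close> searches for t.\<close>

lemma uniform_index:
  assumes "decidable {z. Q (pfst z) (pfst (psnd z)) (psnd (psnd z))}"
  obtains h where "computable h" "\<And>l. W (h l) = {x. \<exists>t. Q l x t}"
proof -
  \<comment> \<open>\<open>Mu\<close> appends its search variable last, hence the regrouping to ((l,
    x), t); zero stands for success.\<close>
  have *: "computable (\<lambda>z. if Q (pfst (pfst z)) (psnd (pfst z)) (psnd z) then 0 else 1)"
    by (intro computable_intros decidable_comp3[OF assms])
  obtain p where
    p: "\<And>z. eval p z = Some (if Q (pfst (pfst z)) (psnd (pfst z)) (psnd z) then 0 else 1)"
    using computableE[OF *] by blast
  define q where "q l = Comp (Mu p) (Tuple (const_prog l) (Tuple Fst Snd))" for l
  have "computable (\<lambda>l. encode_prog (q l))"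
    unfolding q_def encode_prog.simps by (intro computable_intros)
  moreover have "W (encode_prog (q l)) = {x. \<exists>t. Q l x t}" for l
    unfolding W_def decode_encode_prog by (auto simp: q_def p dom_def)
  ultimately show thesis by (rule that)
qed

section \<open>Locking sequences\<close>

text \<open>Reading divergence as the empty set keeps membership a c.e. condition for computable M.
  For nonempty A, \<open>hyp M \<sigma> = A\<close> still forces M to converge on \<sigma>.\<close>

definition hyp :: "learner \<Rightarrow> nat list \<Rightarrow> nat set" where
  "hyp M \<sigma> = (case M \<sigma> of None \<Rightarrow> {} | Some e \<Rightarrow> W e)"

definition locking :: "learner \<Rightarrow> nat set \<Rightarrow> nat list \<Rightarrow> bool" where
  "locking M A \<sigma> \<longleftrightarrow> set \<sigma> \<subseteq> A \<and> (\<forall>\<tau>. prefix \<sigma> \<tau> \<and> set \<tau> \<subseteq> A \<longrightarrow> hyp M \<tau> = A)"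

text \<open>By stage t, M must converge on the string coded by r and the set it names must have
  listed x. A single clock for both makes V decidable and monotone.\<close>

lemma hyp_stages:
  assumes "computable_learner M"
  obtains V where "decidable {z. V (pfst z) (pfst (psnd z)) (psnd (psnd z))}"
    "\<And>s t r x. V s r x \<Longrightarrow> s \<le> t \<Longrightarrow> V t r x"
    "\<And>r x. x \<in> hyp M (list_decode r) \<longleftrightarrow> (\<exists>t. V t r x)"
proof -
  obtain p where p: "(\<lambda>x. M (list_decode x)) = eval p"
    using assms unfolding computable_learner_def partial_computable_def ..
  define m where "m = encode_prog p"
  have M: "M (list_decode r) = Some e \<longleftrightarrow> (\<exists>t. returns_by t m r e)" for r e
    unfolding returns_by_iff m_def decode_encode_prog by (simp flip: p)
  define V where "V t r x \<longleftrightarrow> (\<exists>e<derived t. returns_by t m r e \<and> W_by t e x)" for t r x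
  have V: "V t r x \<longleftrightarrow> (\<exists>e. returns_by t m r e \<and> W_by t e x)" for t r x
    unfolding V_def returns_by_def by (blast dest: triple_in_bound)
  show thesis
  proof (rule that)
    show "decidable {z. V (pfst z) (pfst (psnd z)) (psnd (psnd z))}"
      unfolding V_def by (intro computable_intros)
    show "V t r x" if "V s r x" "s \<le> t" for s t r x
      using that unfolding V by (blast intro: returns_by_mono W_by_mono)
    have "x \<in> hyp M (list_decode r) \<longleftrightarrow> (\<exists>e s t. returns_by s m r e \<and> W_by t e x)" for r x
    proof -
      have "x \<in> hyp M (list_decode r) \<longleftrightarrow> (\<exists>e. M (list_decode r) = Some e \<and> x \<in> W e)"
        by (auto simp: hyp_def split: option.split)
      then show ?thesis unfolding M mem_W_iff by blast
    qed
    also have "(\<exists>e s t. returns_by s m r e \<and> W_by t e x) \<longleftrightarrow> (\<exists>t. V t r x)" for r x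
      unfolding V by (blast intro: returns_by_mono W_by_mono max.cobounded1 max.cobounded2)
    finally show "x \<in> hyp M (list_decode r) \<longleftrightarrow> (\<exists>t. V t r x)" for r x .
  qed
qed

lemma set_init_seg: "set (init_seg f n) = f ` {..<n}"
  by (auto simp: init_seg_def)

lemma set_init_seg_subset: "set (init_seg f n) \<subseteq> content f"
  by (auto simp: set_init_seg content_def)

lemma eventually_subset_init_seg:
  assumes "finite F" "F \<subseteq> content f"
  shows "\<forall>\<^sub>F n in sequentially. F \<subseteq> set (init_seg f n)"
proof -
  have "\<forall>\<^sub>F n in sequentially. x \<in> set (init_seg f n)" if x: "x \<in> F" for x
  proof -
    obtain i where "f i = x" using x assms(2) unfolding content_def by blast
    then show ?thesis
      unfolding set_init_seg by (intro eventually_mono[OF eventually_gt_at_top[of i]]) auto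
  qed
  then have "\<forall>\<^sub>F n in sequentially. \<forall>x\<in>F. x \<in> set (init_seg f n)"
    using assms(1) by (simp add: eventually_ball_finite)
  then show ?thesis by (rule eventually_mono) blast
qed

lemma eventually_less_list_encode_init_seg:
  "\<forall>\<^sub>F n in sequentially. k < list_encode (init_seg f n)"
proof (rule eventually_mono[OF eventually_gt_at_top[of k]])
  fix n assume "k < n"
  then show "k < list_encode (init_seg f n)"
    using length_le_list_encode[of "init_seg f n"] by (simp add: init_seg_def)
qed

section \<open>The pooled hypotheses and their learner\<close>

abbreviation code_within :: "nat \<Rightarrow> nat \<Rightarrow> bool" where
  "code_within k l \<equiv> \<forall>y\<in>set (list_decode k). y \<in> set (list_decode l)"

abbreviation code_prefix :: "nat \<Rightarrow> nat \<Rightarrow> bool" where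
  "code_prefix k l \<equiv> prefix (list_decode k) (list_decode l)"

text \<open>
  On data \<open>l\<close>, a string \<open>k\<close> proposes the intersection of the hypotheses of its extensions. The
  last conjunct blocks proposals going beyond \<open>A\<close>: any \<open>j < k\<close> that is locking for \<open>A\<close> has only
  extensions with hypothesis \<open>A\<close>. It does not block the right proposal, since every \<open>j\<close> is
  extended by a locking string.
\<close>

definition pooled_hyp :: "learner \<Rightarrow> nat \<Rightarrow> nat set" where
  "pooled_hyp M l = {x. \<exists>k<l. code_within k l \<and>
     (\<forall>r<l. code_within r l \<and> code_prefix k r \<longrightarrow> x \<in> hyp M (list_decode r)) \<and>
     (\<forall>j<k. code_within j l \<longrightarrow>
        (\<exists>r<l. code_within r l \<and> code_prefix j r \<and> x \<in> hyp M (list_decode r)))}"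

text \<open>Every x in A is proposed by k0. Conversely, let k propose x. If k \<le> k0, some
  extension of k over the data is locking, and its hypothesis A contains x. If k0 < k, then k0 is
  among the strings that must confirm x, and its extensions over the data all have hypothesis
  A.\<close>

lemma pooled_hyp_eq:
  assumes l: "set (list_decode l) \<subseteq> A"
    and k0: "locking M A (list_decode k0)" "k0 < l" "code_within k0 l"
    and ext: "\<And>j. j \<le> k0 \<Longrightarrow> set (list_decode j) \<subseteq> A \<Longrightarrow>
      \<exists>r<l. code_within r l \<and> code_prefix j r \<and> locking M A (list_decode r)"
  shows "pooled_hyp M l = A"
proof (intro equalityI subsetI)
  have within: "set (list_decode r) \<subseteq> A" if "code_within r l" for r
    using that l by blast
  have hyp: "hyp M (list_decode r) = A" if "code_within r l" "code_prefix k0 r" for r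
    using k0(1) that within unfolding locking_def by blast
  have ext': "\<exists>r<l. code_within r l \<and> code_prefix j r \<and> hyp M (list_decode r) = A"
    if "j \<le> k0" "code_within j l" for j
    using ext[OF that(1) within[OF that(2)]] unfolding locking_def by blast
  fix x
  show "x \<in> pooled_hyp M l" if "x \<in> A"
    unfolding pooled_hyp_def using that k0(2,3) hyp ext'
    by (intro CollectI exI[of _ k0]) (metis less_imp_le)
  assume "x \<in> pooled_hyp M l"
  then obtain k where k: "k < l" "code_within k l"
    "\<And>r. r < l \<Longrightarrow> code_within r l \<Longrightarrow> code_prefix k r \<Longrightarrow> x \<in> hyp M (list_decode r)"
    "\<And>j. j < k \<Longrightarrow> code_within j l \<Longrightarrow>
        \<exists>r<l. code_within r l \<and> code_prefix j r \<and> x \<in> hyp M (list_decode r)"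
    unfolding pooled_hyp_def by blast
  show "x \<in> A"
  proof (cases "k \<le> k0")
    case True
    then show ?thesis using ext'[OF True k(2)] k(3) by blast
  next
    case False
    then obtain r where "code_within r l" "code_prefix k0 r" "x \<in> hyp M (list_decode r)"
      using k(4)[of k0] k0(3) by auto
    then show ?thesis using hyp by blast
  qed
qed

text \<open>All quantifiers over strings are bounded in terms of l, so the stages of the finitely
  many positive facts can be merged into one; this makes membership a c.e. condition, uniformly in
  l.\<close>

lemma pooled_hyp_index:
  assumes "computable_learner M"
  obtains h where "computable h" "\<And>l. W (h l) = pooled_hyp M l"
proof -
  obtain V where V: "decidable {z. V (pfst z) (pfst (psnd z)) (psnd (psnd z))}"
    and V_mono: "\<And>s t r x. V s r x \<Longrightarrow> s \<le> t \<Longrightarrow> V t r x"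
    and hyp: "\<And>r x. x \<in> hyp M (list_decode r) \<longleftrightarrow> (\<exists>t. V t r x)"
    using hyp_stages[OF assms] by blast
  define Q where "Q l x t \<longleftrightarrow> (\<exists>k<l. code_within k l \<and>
     (\<forall>r<l. code_within r l \<and> code_prefix k r \<longrightarrow> V t r x) \<and>
     (\<forall>j<k. code_within j l \<longrightarrow> (\<exists>r<l. code_within r l \<and> code_prefix j r \<and> V t r x)))"
    for l x t
  have *: "decidable {z. Q (pfst z) (pfst (psnd z)) (psnd (psnd z))}"
    unfolding Q_def by (intro computable_intros decidable_comp3[OF V])
  obtain h where h: "computable h" "\<And>l. W (h l) = {x. \<exists>t. Q l x t}"
    using uniform_index[OF *] by blast
  have "{x. \<exists>t. Q l x t} = pooled_hyp M l" for l
  proof (intro equalityI subsetI)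
    fix x assume "x \<in> {x. \<exists>t. Q l x t}"
    then obtain t k where k: "k < l" "code_within k l"
      and V1: "\<forall>r<l. code_within r l \<and> code_prefix k r \<longrightarrow> V t r x"
      and V2: "\<forall>j<k. code_within j l \<longrightarrow> (\<exists>r<l. code_within r l \<and> code_prefix j r \<and> V t r x)"
      unfolding Q_def by (elim CollectE exE conjE) simp
    show "x \<in> pooled_hyp M l"
      unfolding pooled_hyp_def hyp
    proof (rule CollectI, rule exI[of _ k], intro conjI allI impI)
      show "\<exists>t. V t r x" if "r < l" "code_within r l \<and> code_prefix k r" for r
        using V1 that by blast
      show "\<exists>r<l. code_within r l \<and> code_prefix j r \<and> (\<exists>t. V t r x)"
        if "j < k" "code_within j l" for j
        using V2 that by blast
    qed (use k in auto)
  next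
    fix x assume "x \<in> pooled_hyp M l"
    then obtain k where k: "k < l" "code_within k l"
      "\<forall>r<l. code_within r l \<and> code_prefix k r \<longrightarrow> (\<exists>t. V t r x)"
      "\<forall>j<k. code_within j l \<longrightarrow> (\<exists>r<l. code_within r l \<and> code_prefix j r \<and> (\<exists>t. V t r x))"
      unfolding pooled_hyp_def hyp by (elim CollectE exE conjE) simp
    have "\<exists>s. \<forall>r<l. code_within r l \<and> code_prefix k r \<longrightarrow> V s r x"
    proof (rule ex_common_stage[THEN iffD1])
      show "code_within r l \<and> code_prefix k r \<longrightarrow> V t r x"
        if "code_within r l \<and> code_prefix k r \<longrightarrow> V s r x" "s \<le> t" for r s t
        using that(1) V_mono[OF _ that(2)] by blast
    qed (use k(3) in blast)
    then obtain s where s: "\<And>r. r < l \<Longrightarrow> code_within r l \<Longrightarrow> code_prefix k r \<Longrightarrow> V s r x"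
      by blast
    have "\<exists>t. \<forall>j<k. code_within j l \<longrightarrow> (\<exists>r<l. code_within r l \<and> code_prefix j r \<and> V t r x)"
    proof (rule ex_common_stage[THEN iffD1])
      show "code_within j l \<longrightarrow> (\<exists>r<l. code_within r l \<and> code_prefix j r \<and> V t r x)"
        if "code_within j l \<longrightarrow> (\<exists>r<l. code_within r l \<and> code_prefix j r \<and> V s r x)" "s \<le> t"
        for j s t
        using that(1) V_mono[OF _ that(2)] by blast
    qed (use k(4) in blast)
    then obtain t where t: "\<And>j. j < k \<Longrightarrow> code_within j l \<Longrightarrow>
        \<exists>r<l. code_within r l \<and> code_prefix j r \<and> V t r x"
      by blast
    have "Q l x (max s t)"
      unfolding Q_def
    proof (rule exI[of _ k], intro conjI allI impI)
      show "V (max s t) r x" if "r < l" "code_within r l \<and> code_prefix k r" for r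
        using s that V_mono[OF _ max.cobounded1] by blast
      show "\<exists>r<l. code_within r l \<and> code_prefix j r \<and> V (max s t) r x"
        if "j < k" "code_within j l" for j
        using t[OF that] V_mono[OF _ max.cobounded2] by blast
    qed (use k(1,2) in auto)
    then show "x \<in> {x. \<exists>t. Q l x t}" by blast
  qed
  with h show thesis by (intro that[of h]) simp_all
qed

text \<open>N is fixed before A, so one machine serves all sets in which locking strings are dense.
  On a text for A, the finitely many strings over A with code up to k0 eventually have locking
  extensions within the data, and \<open>pooled_hyp_eq\<close> applies.\<close>

lemma learner_of_locking:
  assumes "computable_learner M"
  obtains N where "computable_learner N"
    "\<And>A. (\<And>\<sigma>. set \<sigma> \<subseteq> A \<Longrightarrow> \<exists>\<tau>. prefix \<sigma> \<tau> \<and> locking M A \<tau>) \<Longrightarrow> TxtBC_learns N A"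
proof -
  obtain h where h: "computable h" "\<And>l. W (h l) = pooled_hyp M l"
    using pooled_hyp_index[OF assms] by blast
  define N where "N \<sigma> = Some (h (list_encode \<sigma>))" for \<sigma>
  have "computable_learner N"
    using h(1) by (simp add: computable_learner_def N_def)
  moreover have "TxtBC_learns N A"
    if dense: "\<And>\<sigma>. set \<sigma> \<subseteq> A \<Longrightarrow> \<exists>\<tau>. prefix \<sigma> \<tau> \<and> locking M A \<tau>" for A
    unfolding TxtBC_learns_def
  proof (intro allI impI)
    fix f assume f: "content f = A"
    define l where "l n = list_encode (init_seg f n)" for n
    have l: "list_decode (l n) = init_seg f n" for n by (simp add: l_def)
    have dense': "\<exists>r. code_prefix j r \<and> locking M A (list_decode r)"
      if "set (list_decode j) \<subseteq> A" for j
      using dense[OF that] by (metis list_encode_inverse)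
    \<comment> \<open>0 codes the empty string, which lies over every set.\<close>
    then obtain k0 where k0: "locking M A (list_decode k0)"
      using dense'[of 0] by auto
    have ev: "\<forall>\<^sub>F n in sequentially. r < l n \<and> code_within r (l n)"
      if "set (list_decode r) \<subseteq> A" for r
    proof -
      have "\<forall>\<^sub>F n in sequentially. set (list_decode r) \<subseteq> set (init_seg f n)"
        using that f by (intro eventually_subset_init_seg) auto
      then show ?thesis
        using eventually_less_list_encode_init_seg[of r f]
        by eventually_elim (auto simp: l_def)
    qed
    have "\<forall>\<^sub>F n in sequentially. set (list_decode j) \<subseteq> A \<longrightarrow>
        (\<exists>r<l n. code_within r (l n) \<and> code_prefix j r \<and> locking M A (list_decode r))" for j
    proof (cases "set (list_decode j) \<subseteq> A")
      case True
      then obtain r where r: "code_prefix j r" "locking M A (list_decode r)"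
        using dense' by blast
      then have "set (list_decode r) \<subseteq> A" by (simp add: locking_def)
      from ev[OF this] show ?thesis by (rule eventually_mono) (use r in blast)
    qed simp
    then have "\<forall>\<^sub>F n in sequentially. \<forall>j\<in>{..k0}. set (list_decode j) \<subseteq> A \<longrightarrow>
        (\<exists>r<l n. code_within r (l n) \<and> code_prefix j r \<and> locking M A (list_decode r))"
      by (intro eventually_ball_finite) auto
    moreover have "\<forall>\<^sub>F n in sequentially. k0 < l n \<and> code_within k0 (l n)"
      using ev k0 by (simp add: locking_def)
    ultimately have "\<forall>\<^sub>F n in sequentially. pooled_hyp M (l n) = A"
    proof eventually_elim
      case (elim n)
      then show ?case
        using set_init_seg_subset[of f n] k0
        by (intro pooled_hyp_eq[of "l n" A M k0]) (auto simp: l f)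
    qed
    then obtain n where "\<And>i. i \<ge> n \<Longrightarrow> pooled_hyp M (l i) = A"
      by (auto simp: eventually_sequentially)
    then show "TxtBC_identifies N f"
      unfolding TxtBC_identifies_def
      by (intro exI[of _ n]) (simp add: N_def h(2) f flip: l_def)
  qed
  ultimately show thesis by (rule that)
qed

section \<open>Limits of computable functions\<close>

text \<open>One direction of the limit lemma. A property of the limit holds iff it holds of all
  approximations from some stage on, a Sigma_2 form. Used for equality and for inequality, this
  covers the graph and its complement.\<close>

lemma Delta02_fun_limit:
  assumes g: "computable (\<lambda>z. g (pfst z) (psnd z))"
    and lim: "\<And>n. \<forall>\<^sub>F s in sequentially. g s n = f n"
  shows "Delta02_fun f"
proof -
  have ev: "P (f n) \<longleftrightarrow> (\<exists>a. \<forall>b. a \<le> b \<longrightarrow> P (g b n))" for P n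
  proof -
    obtain a where a: "\<And>b. a \<le> b \<Longrightarrow> g b n = f n"
      using lim[of n] by (auto simp: eventually_sequentially)
    show ?thesis
    proof
      assume "P (f n)"
      with a have "\<forall>b. a \<le> b \<longrightarrow> P (g b n)" by simp
      then show "\<exists>a. \<forall>b. a \<le> b \<longrightarrow> P (g b n)" ..
    next
      assume "\<exists>a. \<forall>b. a \<le> b \<longrightarrow> P (g b n)"
      then obtain a' where "\<And>b. a' \<le> b \<Longrightarrow> P (g b n)" by blast
      from this[of "max a a'"] show "P (f n)" by (simp add: a)
    qed
  qed
  have Sigma: "Sigma02 {x. P (psnd x) (f (pfst x))}"
    if "decidable {z. P (pfst z) (psnd z)}" for P
  proof -
    define R where "R = {z. pfst (psnd z) \<le> psnd (psnd z) \<longrightarrow>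
      P (psnd (pfst z)) (g (psnd (psnd z)) (pfst (pfst z)))}"
    have "decidable R"
      unfolding R_def by (intro computable_intros decidable_comp2[OF that] computable_comp2[OF g])
    moreover have "P (psnd x) (f (pfst x)) \<longleftrightarrow>
        (\<exists>a. \<forall>b. prod_encode (x, prod_encode (a, b)) \<in> R)" for x
      using ev[of "P (psnd x)" "pfst x"] by (simp add: R_def)
    ultimately show ?thesis
      unfolding Sigma02_def by blast
  qed
  have "range (\<lambda>n. prod_encode (n, f n)) = {x. psnd x = f (pfst x)}"
  proof (intro equalityI subsetI)
    fix x assume "x \<in> {x. psnd x = f (pfst x)}"
    then have "x = prod_encode (pfst x, f (pfst x))"
      by (metis (mono_tags) mem_Collect_eq prod.collapse prod_decode_inverse)
    then show "x \<in> range (\<lambda>n. prod_encode (n, f n))" by blast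
  qed auto
  moreover have "Sigma02 {x. psnd x = f (pfst x)}" "Sigma02 {x. psnd x \<noteq> f (pfst x)}"
    by (rule Sigma; intro computable_intros)+
  ultimately show ?thesis
    unfolding Delta02_fun_def Delta02_def by (simp add: Collect_neg_eq)
qed

text \<open>Every w below the true minimum is refuted at some stage. The alternative w = s makes the
  search at stage s stop, and it cannot undercut the minimum once s has reached it.\<close>

lemma Least_all_stages_limit:
  fixes P :: "nat \<Rightarrow> nat \<Rightarrow> bool"
  assumes "\<exists>w. \<forall>s. P w s"
  shows "\<forall>\<^sub>F s in sequentially.
    (LEAST w. w = s \<or> (\<forall>s'<s. P w s')) = (LEAST w. \<forall>s. P w s)"
proof -
  define w0 where "w0 = (LEAST w. \<forall>s. P w s)"
  have w0: "\<forall>s. P w0 s" unfolding w0_def using assms by (rule LeastI_ex)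
  have "\<forall>\<^sub>F s in sequentially. \<not> (\<forall>s'<s. P w s')" if w: "w \<in> {..<w0}" for w
  proof -
    obtain s where "\<not> P w s" using not_less_Least[of w] w unfolding w0_def by blast
    then show ?thesis by (intro eventually_mono[OF eventually_gt_at_top[of s]]) auto
  qed
  then have "\<forall>\<^sub>F s in sequentially. \<forall>w\<in>{..<w0}. \<not> (\<forall>s'<s. P w s')"
    by (intro eventually_ball_finite) auto
  with eventually_ge_at_top[of w0] have "\<forall>\<^sub>F s in sequentially.
      (LEAST w. w = s \<or> (\<forall>s'<s. P w s')) = w0"
  proof eventually_elim
    case (elim s)
    show ?case
    proof (rule Least_equality)
      show "w0 \<le> w" if "w = s \<or> (\<forall>s'<s. P w s')" for w
        using that
      proof
        assume "\<forall>s'<s. P w s'"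
        with elim(2) have "w \<notin> {..<w0}" by blast
        then show "w0 \<le> w" by simp
      qed (use elim(1) in simp)
    qed (use w0 in blast)
  qed
  then show ?thesis by (simp only: w0_def)
qed

section \<open>A text without locking prefixes\<close>

lemma eventually_W_by:
  assumes "x \<in> W e"
  shows "\<forall>\<^sub>F t in sequentially. W_by t e x"
proof -
  obtain s where "W_by s e x" using assms unfolding mem_W_iff ..
  then show ?thesis
    by (intro eventually_mono[OF eventually_ge_at_top[of s]]) (rule W_by_mono)
qed

text \<open>
  A search result \<open>w\<close> codes \<open>(\<beta>, \<rho>, x, t)\<close>: the next initial segment \<open>\<beta>\<close>, a prefix \<open>\<rho>\<close> of it on
  which the hypothesis differs from \<open>A\<close>, and the element \<open>x\<close> at which it does. All that has to be
  known about \<open>w\<close> is of the form \<open>\<forall>s. P w s\<close> with decidable \<open>P\<close>, so that the least \<open>w\<close> is a limit.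
\<close>

lemma text_without_locking:
  assumes M: "computable_learner M" and A: "ce A" "A \<noteq> {}" and \<sigma>: "set \<sigma> \<subseteq> A"
    and no_lock: "\<And>\<tau>. prefix \<sigma> \<tau> \<Longrightarrow> \<not> locking M A \<tau>"
  shows "\<exists>f. Delta02_fun f \<and> content f = A \<and> \<not> TxtBC_identifies M f"
proof -
  obtain e where e: "A = W e" using A(1) range_W by blast
  obtain V where V: "decidable {z. V (pfst z) (pfst (psnd z)) (psnd (psnd z))}"
    and V_mono: "\<And>s t r x. V s r x \<Longrightarrow> s \<le> t \<Longrightarrow> V t r x"
    and hyp: "\<And>r x. x \<in> hyp M (list_decode r) \<longleftrightarrow> (\<exists>t. V t r x)"
    using hyp_stages[OF M] by blast
  \<comment> \<open>Here t witnesses the positive facts, while s ranges over all stages to check the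
    negative ones. Under the quantifier over s, the last two clauses say that \<beta> lists k if k
    is in A, and that x separates A from the hypothesis on \<rho>.\<close>
  define Q where "Q \<alpha> k \<beta> \<rho> x t s \<longleftrightarrow> code_prefix \<alpha> \<rho> \<and> code_prefix \<rho> \<beta> \<and>
      k < length (list_decode \<rho>) \<and> (\<forall>y\<in>set (list_decode \<beta>). W_by t e y) \<and>
      (W_by s e k \<longrightarrow> k \<in> set (list_decode \<beta>)) \<and>
      (W_by t e x \<and> \<not> V s \<rho> x \<or> V t \<rho> x \<and> \<not> W_by s e x)" for \<alpha> k \<beta> \<rho> x t s
  define P where "P \<alpha> k w s \<longleftrightarrow>
      Q \<alpha> k (pfst w) (pfst (psnd w)) (pfst (psnd (psnd w))) (psnd (psnd (psnd w))) s" for \<alpha> k w s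
  \<comment> \<open>All k rounds are run with the search cut off at s; the rounds settle one after
    another as s grows.\<close>
  define stage where "stage s k = rec_nat (list_encode \<sigma>)
      (\<lambda>k \<alpha>. pfst (LEAST w. w = s \<or> (\<forall>s'<s. P \<alpha> k w s'))) k" for s k
  define \<alpha> where "\<alpha> k = rec_nat (list_encode \<sigma>) (\<lambda>k \<alpha>. pfst (LEAST w. \<forall>s. P \<alpha> k w s)) k" for k
  define seg where "seg k = list_decode (\<alpha> k)" for k
  \<comment> \<open>Position n exists in \<open>seg (Suc n)\<close> because the \<rho> of round n is
    longer than n.\<close>
  define f where "f n = seg (Suc n) ! n" for n

  have ex: "\<exists>w. \<forall>s. P a k w s" if a: "prefix \<sigma> (list_decode a)" "set (list_decode a) \<subseteq> A" for a k
  proof -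
    obtain a0 where "a0 \<in> A" using A(2) by blast
    \<comment> \<open>Padding with elements of A ensures length above k before an extension with a
      wrong hypothesis is taken.\<close>
    define \<tau> where "\<tau> = list_decode a @ replicate (Suc k) a0"
    have \<tau>: "prefix (list_decode a) \<tau>" "set \<tau> \<subseteq> A" "k < length \<tau>"
      using a \<open>a0 \<in> A\<close> by (auto simp: \<tau>_def)
    have "\<not> locking M A \<tau>"
      using a(1) \<tau>(1) by (intro no_lock) (rule prefix_order.trans)
    then obtain r where r: "prefix \<tau> r" "set r \<subseteq> A" "hyp M r \<noteq> A"
      using \<tau>(2) by (auto simp: locking_def)
    \<comment> \<open>Appending k after r keeps r as a prefix with a wrong hypothesis, while the
      text comes to exhaust A.\<close>
    define b where "b = r @ (if k \<in> A then [k] else [])"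
    have b: "prefix r b" "set b \<subseteq> A" "k \<in> A \<Longrightarrow> k \<in> set b"
      using r(2) by (auto simp: b_def)
    have "k < length r" using \<tau>(3) prefix_length_le[OF r(1)] by simp
    have "prefix (list_decode a) r" using \<tau>(1) r(1) by (rule prefix_order.trans)
    have "\<forall>\<^sub>F t in sequentially. \<forall>y\<in>set b. W_by t e y"
      using b(2) by (intro eventually_ball_finite ballI eventually_W_by) (auto simp: e)
    then obtain t0 where t0: "\<And>y t. y \<in> set b \<Longrightarrow> t0 \<le> t \<Longrightarrow> W_by t e y"
      unfolding eventually_sequentially by blast
    obtain x t1 where x: "W_by t1 e x \<and> x \<notin> hyp M r \<or> V t1 (list_encode r) x \<and> x \<notin> A"
      using r(3) hyp[of _ "list_encode r"] by (auto simp: e set_eq_iff mem_W_iff)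
    define t where "t = max t0 t1"
    have "W_by t e x \<and> x \<notin> hyp M r \<or> V t (list_encode r) x \<and> x \<notin> A"
      using x W_by_mono V_mono unfolding t_def by (meson max.cobounded2)
    then have "\<forall>s. Q a k (list_encode b) (list_encode r) x t s"
      using b \<open>k < length r\<close> \<open>prefix (list_decode a) r\<close> t0[of _ t] hyp[of x "list_encode r"]
      by (auto simp: Q_def t_def e mem_W_iff)
    then show ?thesis
      by (intro exI[of _ "prod_encode (list_encode b,
        prod_encode (list_encode r, prod_encode (x, t)))"]) (simp add: P_def)
  qed

  \<comment> \<open>Conversely, any w that passes all stages is a correct move, so the least one can
    be taken.\<close>
  have step: "set (list_decode (pfst w)) \<subseteq> A \<and> (k \<in> A \<longrightarrow> k \<in> set (list_decode (pfst w))) \<and>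
      (\<exists>r. prefix (list_decode a) r \<and> prefix r (list_decode (pfst w)) \<and> k < length r \<and> hyp M r \<noteq> A)"
    if w: "\<forall>s. P a k w s" for a k w
  proof -
    obtain b r x t where Q: "\<And>s. Q a k b r x t s" and b: "pfst w = b"
      using w unfolding P_def by blast
    have "hyp M (list_decode r) \<noteq> A"
      using Q unfolding Q_def e set_eq_iff hyp mem_W_iff by blast
    moreover have "k \<in> A \<longrightarrow> k \<in> set (list_decode b)"
      using Q unfolding Q_def e mem_W_iff by blast
    moreover have "set (list_decode b) \<subseteq> A"
      using Q unfolding Q_def e subset_iff mem_W_iff by blast
    ultimately show ?thesis
      using Q[of 0] unfolding Q_def b by blast
  qed

  have seg_0: "seg 0 = \<sigma>" by (simp add: seg_def \<alpha>_def)
  have step_seg: "set (seg (Suc k)) \<subseteq> A \<and> (k \<in> A \<longrightarrow> k \<in> set (seg (Suc k))) \<and>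
      (\<exists>r. prefix (seg k) r \<and> prefix r (seg (Suc k)) \<and> k < length r \<and> hyp M r \<noteq> A)"
    if "prefix \<sigma> (seg k)" "set (seg k) \<subseteq> A" for k
  proof -
    have "\<forall>s. P (\<alpha> k) k (LEAST w. \<forall>s. P (\<alpha> k) k w s) s"
      by (rule LeastI_ex) (rule ex[OF that[unfolded seg_def]])
    moreover have "\<alpha> (Suc k) = pfst (LEAST w. \<forall>s. P (\<alpha> k) k w s)"
      by (simp add: \<alpha>_def)
    ultimately show ?thesis using step unfolding seg_def by simp
  qed
  have seg: "prefix \<sigma> (seg k) \<and> set (seg k) \<subseteq> A" for k
  proof (induction k)
    case 0
    then show ?case using \<sigma> by (simp add: seg_0)
  next
    case (Suc k)
    then obtain r where r: "prefix (seg k) r" "prefix r (seg (Suc k))" "set (seg (Suc k)) \<subseteq> A"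
      using step_seg[of k] by blast
    have "prefix (seg k) (seg (Suc k))" using r(1,2) by (rule prefix_order.trans)
    with Suc r(3) show ?case by (meson prefix_order.trans)
  qed
  have seg_Suc: "(k \<in> A \<longrightarrow> k \<in> set (seg (Suc k))) \<and>
      (\<exists>r. prefix (seg k) r \<and> prefix r (seg (Suc k)) \<and> k < length r \<and> hyp M r \<noteq> A)" for k
    using step_seg[of k] seg[of k] by blast

  have seg_mono: "prefix (seg j) (seg k)" if "j \<le> k" for j k
    using that
  proof (induction rule: dec_induct)
    case (step k)
    then show ?case using seg_Suc[of k] by (meson prefix_order.trans)
  qed simp
  have length_seg: "k < length (seg (Suc k))" for k
    using seg_Suc[of k] prefix_length_le by (metis less_le_trans)
  \<comment> \<open>The segments form a chain of prefixes, so any one that is long enough gives the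
    same value at n.\<close>
  have f_nth: "f n = seg k ! n" if "n < length (seg k)" for n k
    using seg_mono[of k "Suc n"] seg_mono[of "Suc n" k] that length_seg[of n]
    unfolding f_def prefix_def by (metis nat_le_linear nth_append)
  have init: "init_seg f (length r) = r" if "prefix r (seg k)" for r k
    using that by (intro nth_equalityI)
      (auto simp: init_seg_def f_nth[of _ k] prefix_def nth_append)

  have "content f = A"
  proof (intro equalityI subsetI)
    fix x assume "x \<in> content f"
    then obtain n where "x = f n" unfolding content_def by blast
    then have "x \<in> set (seg (Suc n))" using length_seg[of n] by (simp add: f_def)
    then show "x \<in> A" using seg by blast
  next
    fix x assume "x \<in> A"
    then have "x \<in> set (init_seg f (length (seg (Suc x))))"
      using seg_Suc init[of "seg (Suc x)" "Suc x"] by simp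
    then show "x \<in> content f" using set_init_seg_subset by blast
  qed
  moreover have "\<not> TxtBC_identifies M f"
  proof
    assume "TxtBC_identifies M f"
    then obtain n where n: "\<And>i. i > n \<Longrightarrow> \<exists>e. M (init_seg f i) = Some e \<and> W e = content f"
      unfolding TxtBC_identifies_def by blast
    obtain r where "prefix r (seg (Suc n))" "n < length r" "hyp M r \<noteq> A"
      using seg_Suc[of n] by blast
    then show False
      using n[of "length r"] init \<open>content f = A\<close> by (auto simp: hyp_def)
  qed
  moreover have "Delta02_fun f"
  proof (rule Delta02_fun_limit)
    have *: "decidable {z. P (pfst z) (pfst (psnd z)) (pfst (psnd (psnd z))) (psnd (psnd (psnd z)))}"
      unfolding P_def Q_def by (intro computable_intros decidable_comp3[OF V])
    have P: "decidable {z. P (h1 z) (h2 z) (h3 z) (h4 z)}"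
      if "computable h1" "computable h2" "computable h3" "computable h4" for h1 h2 h3 h4
      using decidable_comp[OF *, of "\<lambda>z. prod_encode (h1 z, prod_encode (h2 z, prod_encode (h3 z, h4 z)))"]
        that by (simp add: computable_intros)
    \<comment> \<open>The alternative w = s supplies the existence of a search result that
      \<open>computable_Least\<close> requires.\<close>
    have stage_computable: "computable (\<lambda>z. stage (pfst z) (psnd z))"
      unfolding stage_def by (intro computable_intros P) blast
    show "computable (\<lambda>z. lhd (ldrop (psnd z) (stage (pfst z) (Suc (psnd z)))))"
      by (intro computable_intros computable_comp2[OF stage_computable])
    \<comment> \<open>Once the approximation to \<open>\<alpha> k\<close> has settled, round k
      searches with a fixed predicate and settles too.\<close>
    have stage: "\<forall>\<^sub>F s in sequentially. stage s k = \<alpha> k" for k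
    proof (induction k)
      case (Suc k)
      have "\<forall>\<^sub>F s in sequentially. (LEAST w. w = s \<or> (\<forall>s'<s. P (\<alpha> k) k w s'))
          = (LEAST w. \<forall>s. P (\<alpha> k) k w s)"
        using ex[of "\<alpha> k" k] seg[of k] unfolding seg_def by (intro Least_all_stages_limit) blast
      with Suc show ?case
        by eventually_elim (simp add: stage_def \<alpha>_def)
    qed (simp add: stage_def \<alpha>_def)
    show "\<forall>\<^sub>F s in sequentially. lhd (ldrop n (stage s (Suc n))) = f n" for n
      using stage[of "Suc n"]
      by eventually_elim (use length_seg[of n] in \<open>simp add: lhd_ldrop f_def seg_def\<close>)
  qed
  ultimately show ?thesis by blast
qed

section \<open>Members of the family are c.e., and the final dichotomy\<close>

lemma ce_section:
  assumes "ce B"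
  shows "ce {x. prod_encode (i, x) \<in> B}"
proof -
  obtain p where p: "B = dom (eval p)"
    using assms unfolding ce_def partial_computable_def by blast
  have "{x. prod_encode (i, x) \<in> B} = dom (eval (Comp p (Tuple (const_prog i) (Tuple Fst Snd))))"
    by (auto simp: p)
  then show ?thesis
    unfolding ce_def partial_computable_def by blast
qed

theorem theorem4p1:
  fixes \<G> :: "nat set set"
  assumes "uce \<G>"
  shows "TxtBC_learnable \<G> \<or>
    (\<forall>M. computable_learner M \<longrightarrow>
       (\<exists>f. Delta02_fun f \<and> content f \<in> \<G> \<and> \<not> TxtBC_identifies M f))"
proof (rule disjCI)
  assume "\<not> (\<forall>M. computable_learner M \<longrightarrow>
       (\<exists>f. Delta02_fun f \<and> content f \<in> \<G> \<and> \<not> TxtBC_identifies M f))"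
  then obtain M where M: "computable_learner M"
    and ident: "\<And>f. Delta02_fun f \<Longrightarrow> content f \<in> \<G> \<Longrightarrow> TxtBC_identifies M f"
    by blast
  obtain N where N: "computable_learner N"
    "\<And>A. (\<And>\<sigma>. set \<sigma> \<subseteq> A \<Longrightarrow> \<exists>\<tau>. prefix \<sigma> \<tau> \<and> locking M A \<tau>) \<Longrightarrow> TxtBC_learns N A"
    using learner_of_locking[OF M] by blast
  have "TxtBC_learns N A" if "A \<in> \<G>" for A
  proof (cases "A = {}")
    case True
    \<comment> \<open>Enumerations are total functions, so the empty set has none and is learnt
      vacuously.\<close>
    then show ?thesis by (auto simp: TxtBC_learns_def content_def)
  next
    case False
    have "ce A" using assms that by (auto simp: uce_def intro: ce_section)
    show ?thesis
    proof (rule N(2), rule ccontr)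
      fix \<sigma> assume "set \<sigma> \<subseteq> A" "\<not> (\<exists>\<tau>. prefix \<sigma> \<tau> \<and> locking M A \<tau>)"
      then obtain f where "Delta02_fun f" "content f = A" "\<not> TxtBC_identifies M f"
        using text_without_locking[OF M \<open>ce A\<close> False] by blast
      then show False using ident that by blast
    qed
  qed
  with N(1) show "TxtBC_learnable \<G>"
    unfolding TxtBC_learnable_def by blast
qed

end
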